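(* Every rule of the $\forall\exists$ relational logic ERHL+ is sound: for every instance of a rule, if all its judgment premises are valid in the $\forall\exists$ sense and all its side conditions hold, then its conclusion is valid in the $\forall\exists$ sense.
   Context: Stores: total functions $\mathit{Var}\to\mathbb{Z}$. GCL commands $c::=\mathsf{skip}\mid x:=e\mid\mathsf{havoc}\,x\mid c;c\mid\mathsf{if}\,gcs\,\mathsf{fi}\mid\mathsf{do}\,gcs\,\mathsf{od}$ (labels ignored), $gcs$ a nonempty list of guarded commands $e\to c$, $\mathrm{enab}(gcs)$ the disjunction of guards; commands well typed, each $\mathsf{if}\,gcs\,\mathsf{fi}$ having $\mathrm{enab}(gcs)$ valid. Denotation $\llbracket c\rrbracket$: identity for skip; $\{(s,s[x\mapsto\llbracket e\rrbracket(s)])\}$ for $x:=e$; $\{(s,s[x\mapsto v])\mid v\in\mathbb{Z}\}$ for havoc; composition for $;$; for if, the union over $e\to c$ of $\{(s,t)\mid e$ true in $s$, $(s,t)\in\llbracket c\rrbracket\}$; for do, pairs $(s,t)$ connected by finitely many executions of bodies of guarded commands enabled at the start of each iteration, with $\mathrm{enab}(gcs)$ false in $t$. Valid $\forall\exists$ judgment $\models c\mid c':\langle\mathcal{R}\leadsto\mathcal{S}\rangle$: for all $s,s',t$ with $(s,s')\in\mathcal{R}$ and $(s,t)\in\llbracket c\rrbracket$ there is $t'$ with $(s',t')\in\llbracket c'\rrbracket$ and $(t,t')\in\mathcal{S}$. Relational notation: $\langle P]=\{(s,s')\mid s\in P\}$, $[P\rangle=\{(s,s')\mid s'\in P\}$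 (boolean expressions denote the stores where they are true); $\langle e|=|e'\rangle=\{(s,s')\mid\llbracket e\rrbracket(s)=\llbracket e'\rrbracket(s')\}$; $\mathcal{R}[x|:=e|]=\{(s,s')\mid(s[x\mapsto\llbracket e\rrbracket(s)],s')\in\mathcal{R}\}$, $\mathcal{R}[|x:=|e]$ symmetric; $(\forall x|.\mathcal{P})=\{(s,s')\mid\forall v.(s[x\mapsto v],s')\in\mathcal{P}\}$; $(\exists|x.\mathcal{P})=\{(s,s')\mid\exists v.(s,s'[x\mapsto v])\in\mathcal{P}\}$; $\mathrm{indep}(x|x',\mathcal{R})$: $\mathcal{R}=\{(s,s')\mid\exists v,v'.(s[x\mapsto v],s'[x'\mapsto v'])\in\mathcal{R}\}$; $\mathrm{ghost}(x,c)$: $x$ occurs in $c$ only as target of assignments to $x$ and $\mathsf{havoc}\,x$; $\mathrm{erase}(x,c)$ replaces those by $\mathsf{skip}$. $c\simeq d$ means $\mathrm{Hyp}\vdash\lfloor c\rfloor=\lfloor d\rfloor$: $\lfloor\cdot\rfloor$ translates to KAT expressions ($\lfloor\mathsf{skip}\rfloor=1$; assignments, havocs and primitive boolean expressions to primitive symbols; $\wedge,\vee,\neg$ to $;,+,\neg$; $\lfloor c;d\rfloor=\lfloor c\rfloor;\lfloor d\rfloor$; $\lfloor\mathsf{if}\,gcs\,\mathsf{fi}\rfloor=\lfloor gcs\rfloor=\sum_{e\to c\in gcs}\lfloor e\rfloor;\lfloor c\rfloor$; $\lfloor\mathsf{do}\,gcs\,\mathsf{od}\rfloor=\lfloor gcs\rfloor^*;\neg\lfloor\mathrm{enab}(gcs)\rfloor$);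 $\vdash$ is equational and propositional derivability from the Kleene-algebra-with-tests axioms (idempotent semiring with a Boolean algebra of tests, $1+x;x^*=x^*$, $1+x^*;x=x^*$, $y+x;z\le z\Rightarrow x^*;y\le z$, $y+z;x\le z\Rightarrow y;x^*\le z$, with $x\le y$ iff $x+y=y$) plus $\mathrm{Hyp}$ = \{$\lfloor e\rfloor=0$ for unsatisfiable $e$; $\lfloor e_0\rfloor;\lfloor x:=e\rfloor;\neg\lfloor e_1\rfloor=0$ when $e_0\Rightarrow e_1[x:=e]$ valid; $\lfloor e_0\rfloor;\lfloor\mathsf{havoc}\,x\rfloor;\neg\lfloor e_1\rfloor=0$ when $e_0$ implies $e_1$ holds for every value of $x$\}. ERHL+ rules (all judgments $\langle\cdot\leadsto\cdot\rangle$): eGhost, eRewrite, eSkip, eAsgnSkip, eSkipAsgn, eSeq, eIf, eConseq, eDisj, eFalse, having exactly the forms: eGhost from $c\mid c':\langle\mathcal{R}\leadsto\mathcal{S}\rangle$, $\mathrm{ghost}(x,c)$, $\mathrm{ghost}(x',c')$, $\mathrm{indep}(x|x',\mathcal{R})$, $\mathrm{indep}(x|x',\mathcal{S})$ infer $\mathrm{erase}(x,c)\mid\mathrm{erase}(x',c'):\langle\mathcal{R}\leadsto\mathcal{S}\rangle$; eRewrite from $c\mid c':\langle\mathcal{R}\leadsto\mathcal{S}\rangle$, $c\simeq d$, $c'\simeq d'$ infer $d\mid d':\langle\mathcal{R}\leadsto\mathcal{S}\rangle$; eSkip $\mathsf{skip}\mid\mathsf{skip}:\langle\mathcal{R}\leadsto\mathcal{R}\rangle$;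 eAsgnSkip $x:=e\mid\mathsf{skip}:\langle\mathcal{R}[x|:=e|]\leadsto\mathcal{R}\rangle$; eSkipAsgn $\mathsf{skip}\mid x:=e:\langle\mathcal{R}[|x:=|e]\leadsto\mathcal{R}\rangle$; eSeq from $c\mid c':\langle\mathcal{R}\leadsto\mathcal{S}\rangle$, $d\mid d':\langle\mathcal{S}\leadsto\mathcal{T}\rangle$ infer $c;d\mid c';d':\langle\mathcal{R}\leadsto\mathcal{T}\rangle$; eIf from $c\mid c':\langle\mathcal{R}\wedge\langle e]\wedge[e'\rangle\leadsto\mathcal{S}\rangle$ for all $e\to c\in gcs$ and $e'\to c'\in gcs'$ infer $\mathsf{if}\,gcs\,\mathsf{fi}\mid\mathsf{if}\,gcs'\,\mathsf{fi}:\langle\mathcal{R}\leadsto\mathcal{S}\rangle$; eConseq from $\mathcal{P}\subseteq\mathcal{R}$, $c\mid d:\langle\mathcal{R}\leadsto\mathcal{S}\rangle$, $\mathcal{S}\subseteq\mathcal{Q}$ infer $c\mid d:\langle\mathcal{P}\leadsto\mathcal{Q}\rangle$; eDisj from $c\mid d:\langle\mathcal{Q}\leadsto\mathcal{S}\rangle$, $c\mid d:\langle\mathcal{R}\leadsto\mathcal{S}\rangle$ infer $c\mid d:\langle\mathcal{Q}\vee\mathcal{R}\leadsto\mathcal{S}\rangle$; eFalse $c\mid d:\langle\mathit{false}\leadsto\mathcal{R}\rangle$. Plus: eHavSkip $\mathsf{havoc}\,x\mid\mathsf{skip}:\langle(\forall x|.\mathcal{P})\leadsto\mathcal{P}\rangle$;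 eSkipHav $\mathsf{skip}\mid\mathsf{havoc}\,x:\langle(\exists|x.\mathcal{P})\leadsto\mathcal{P}\rangle$; eDo: given a well-founded set $(D,\prec)$ and a variant $V$ mapping stores to $D$, from $c\mid\mathsf{skip}:\langle\mathcal{Q}\wedge\langle e]\wedge\mathcal{L}\leadsto\mathcal{Q}\rangle$ for all $e\to c\in gcs$; $\mathsf{skip}\mid c':\langle\mathcal{Q}\wedge[e'\rangle\wedge\mathcal{R}\wedge[V=k\rangle\leadsto\mathcal{Q}\wedge[V\prec k\rangle\rangle$ for all $e'\to c'\in gcs'$ and all $k\in D$ (where $[V=k\rangle=\{(s,s')\mid V(s')=k\}$ and $[V\prec k\rangle=\{(s,s')\mid V(s')\prec k\}$, $k$ fresh); $c\mid c':\langle\mathcal{Q}\wedge\langle e]\wedge[e'\rangle\wedge\neg\mathcal{L}\wedge\neg\mathcal{R}\leadsto\mathcal{Q}\rangle$ for all $e\to c\in gcs$, $e'\to c'\in gcs'$; and $\mathcal{Q}\subseteq\langle\mathrm{enab}(gcs)|=|\mathrm{enab}(gcs')\rangle\cup(\mathcal{L}\cap\langle\mathrm{enab}(gcs)])\cup(\mathcal{R}\cap[\mathrm{enab}(gcs')\rangle)$, infer $\mathsf{do}\,gcs\,\mathsf{od}\mid\mathsf{do}\,gcs'\,\mathsf{od}:\langle\mathcal{Q}\leadsto\mathcal{Q}\wedge\neg\langle\mathrm{enab}(gcs)]\wedge\neg[\mathrm{enab}(gcs')\rangle\rangle$. *)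

theory Defs
  imports Main
begin

type_synonym 'v store = "'v \<Rightarrow> int"
type_synonym 'v srel = "('v store \<times> 'v store) set"

(* The signature of expressions is left open: an operator or predicate symbol is identified
   with its interpretation on argument lists, so every choice of primitive operations is
   covered (a literal is a nullary operator).  Having separate types of integer and boolean
   expressions makes every command well typed. *)
datatype (ivars: 'v) iexp = Var 'v | Op "int list \<Rightarrow> int" "'v iexp list"

datatype (pvars: 'v) pexp = Pred "int list \<Rightarrow> bool" "'v iexp list"

datatype (bvars: 'v) bexp =
    Prim "'v pexp" | BNot "'v bexp" | BAnd "'v bexp" "'v bexp" | BOr "'v bexp" "'v bexp"

fun ival :: "'v iexp \<Rightarrow> 'v store \<Rightarrow> int" where
  "ival (Var x) s = s x"
| "ival (Op f es) s = f (map (\<lambda>e. ival e s) es)"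

fun bval :: "'v bexp \<Rightarrow> 'v store \<Rightarrow> bool" where
  "bval (Prim (Pred p es)) s = p (map (\<lambda>e. ival e s) es)"
| "bval (BNot b) s = (\<not> bval b s)"
| "bval (BAnd b c) s = (bval b s \<and> bval c s)"
| "bval (BOr b c) s = (bval b s \<or> bval c s)"

fun isubst :: "'v iexp \<Rightarrow> 'v \<Rightarrow> 'v iexp \<Rightarrow> 'v iexp" where
  "isubst (Var y) x a = (if y = x then a else Var y)"
| "isubst (Op f es) x a = Op f (map (\<lambda>e. isubst e x a) es)"

fun bsubst :: "'v bexp \<Rightarrow> 'v \<Rightarrow> 'v iexp \<Rightarrow> 'v bexp" where
  "bsubst (Prim (Pred p es)) x a = Prim (Pred p (map (\<lambda>e. isubst e x a) es))"
| "bsubst (BNot b) x a = BNot (bsubst b x a)"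
| "bsubst (BAnd b c) x a = BAnd (bsubst b x a) (bsubst c x a)"
| "bsubst (BOr b c) x a = BOr (bsubst b x a) (bsubst c x a)"

definition bvalid :: "'v bexp \<Rightarrow> bool" where
  "bvalid b \<longleftrightarrow> (\<forall>s. bval b s)"

definition bset :: "'v bexp \<Rightarrow> 'v store set" where
  "bset b = {s. bval b s}"

datatype 'v cmd =
    Skip
  | Assign 'v "'v iexp"
  | Havoc 'v
  | Seq "'v cmd" "'v cmd"
  | IfFi "('v bexp \<times> 'v cmd) list"
  | DoOd "('v bexp \<times> 'v cmd) list"

type_synonym 'v gcs = "('v bexp \<times> 'v cmd) list"

lemma size_gc [termination_simp]:
  "(e, c) \<in> set gcs \<Longrightarrow> size c < Suc (size_list (size_prod (\<lambda>_. 0) size) gcs)"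
  by (induction gcs) auto

(* The equation for the empty list only makes the function total: well-formed commands
   have nonempty lists of guarded commands. *)
fun enab :: "'v gcs \<Rightarrow> 'v bexp" where
  "enab [] = Prim (Pred (\<lambda>_. False) [])"
| "enab [(e, c)] = e"
| "enab ((e, c) # gc # gcs) = BOr e (enab (gc # gcs))"

fun wf_cmd :: "'v cmd \<Rightarrow> bool" where
  "wf_cmd Skip = True"
| "wf_cmd (Assign x e) = True"
| "wf_cmd (Havoc x) = True"
| "wf_cmd (Seq c d) = (wf_cmd c \<and> wf_cmd d)"
| "wf_cmd (IfFi gcs) = (gcs \<noteq> [] \<and> bvalid (enab gcs) \<and> (\<forall>(e, c) \<in> set gcs. wf_cmd c))"
| "wf_cmd (DoOd gcs) = (gcs \<noteq> [] \<and> (\<forall>(e, c) \<in> set gcs. wf_cmd c))"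

fun den :: "'v cmd \<Rightarrow> 'v srel" where
  "den Skip = Id"
| "den (Assign x e) = {(s, s(x := ival e s)) | s. True}"
| "den (Havoc x) = {(s, s(x := v)) | s v. True}"
| "den (Seq c d) = den c O den d"
| "den (IfFi gcs) = (\<Union>(e, c) \<in> set gcs. {(s, t). bval e s \<and> (s, t) \<in> den c})"
| "den (DoOd gcs) =
     {(s, t). (s, t) \<in> (\<Union>(e, c) \<in> set gcs. {(s, t). bval e s \<and> (s, t) \<in> den c})\<^sup>*
              \<and> \<not> bval (enab gcs) t}"

fun ghost :: "'v \<Rightarrow> 'v cmd \<Rightarrow> bool" where
  "ghost x Skip = True"
| "ghost x (Assign y e) = (x \<notin> ivars e)"
| "ghost x (Havoc y) = True"
| "ghost x (Seq c d) = (ghost x c \<and> ghost x d)"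
| "ghost x (IfFi gcs) = (\<forall>(e, c) \<in> set gcs. x \<notin> bvars e \<and> ghost x c)"
| "ghost x (DoOd gcs) = (\<forall>(e, c) \<in> set gcs. x \<notin> bvars e \<and> ghost x c)"

fun erase :: "'v \<Rightarrow> 'v cmd \<Rightarrow> 'v cmd" where
  "erase x Skip = Skip"
| "erase x (Assign y e) = (if y = x then Skip else Assign y e)"
| "erase x (Havoc y) = (if y = x then Skip else Havoc y)"
| "erase x (Seq c d) = Seq (erase x c) (erase x d)"
| "erase x (IfFi gcs) = IfFi (map (\<lambda>(e, c). (e, erase x c)) gcs)"
| "erase x (DoOd gcs) = DoOd (map (\<lambda>(e, c). (e, erase x c)) gcs)"


section \<open>Kleene algebra with tests\<close>

datatype 'p tst =
    TZero | TOne | TPrim 'p | TNeg "'p tst" | TMult "'p tst" "'p tst" | TPlus "'p tst" "'p tst"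

(* Two-sorted terms: negation is only available on tests.  The constants 0 and 1 of the
   Kleene algebra are those of the test algebra. *)
datatype ('p, 'a) kat =
    Test "'p tst" | Act 'a | Plus "('p, 'a) kat" "('p, 'a) kat" (infixl "\<^bold>+" 65)
  | Mult "('p, 'a) kat" "('p, 'a) kat" (infixl "\<^bold>;" 70) | Star "('p, 'a) kat"

abbreviation Zero :: "('p, 'a) kat" ("\<^bold>0") where "\<^bold>0 \<equiv> Test TZero"
abbreviation One :: "('p, 'a) kat" ("\<^bold>1") where "\<^bold>1 \<equiv> Test TOne"

(* Derivability of equations from a set H of equations.  All KAT axioms are equations or Horn
   clauses, hence closure under their instances and equational reasoning yields all
   propositionally derivable equations. *)
inductive kat_eq ::
    "(('p, 'a) kat \<times> ('p, 'a) kat) set \<Rightarrow> ('p, 'a) kat \<Rightarrow> ('p, 'a) kat \<Rightarrow> bool"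
    ("_ \<turnstile> _ \<approx> _" [51, 51, 51] 50)
  for H where
  kat_hyp: "(x, y) \<in> H \<Longrightarrow> H \<turnstile> x \<approx> y"
| kat_refl: "H \<turnstile> x \<approx> x"
| kat_sym: "H \<turnstile> x \<approx> y \<Longrightarrow> H \<turnstile> y \<approx> x"
| kat_trans: "H \<turnstile> x \<approx> y \<Longrightarrow> H \<turnstile> y \<approx> z \<Longrightarrow> H \<turnstile> x \<approx> z"
| kat_plus_cong: "H \<turnstile> x \<approx> x' \<Longrightarrow> H \<turnstile> y \<approx> y' \<Longrightarrow> H \<turnstile> x \<^bold>+ y \<approx> x' \<^bold>+ y'"
| kat_mult_cong: "H \<turnstile> x \<approx> x' \<Longrightarrow> H \<turnstile> y \<approx> y' \<Longrightarrow> H \<turnstile> x \<^bold>; y \<approx> x' \<^bold>; y'"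
| kat_star_cong: "H \<turnstile> x \<approx> x' \<Longrightarrow> H \<turnstile> Star x \<approx> Star x'"
| kat_neg_cong: "H \<turnstile> Test p \<approx> Test q \<Longrightarrow> H \<turnstile> Test (TNeg p) \<approx> Test (TNeg q)"
| kat_test_plus: "H \<turnstile> Test (TPlus p q) \<approx> Test p \<^bold>+ Test q"
| kat_test_mult: "H \<turnstile> Test (TMult p q) \<approx> Test p \<^bold>; Test q"
| kat_plus_assoc: "H \<turnstile> (x \<^bold>+ y) \<^bold>+ z \<approx> x \<^bold>+ (y \<^bold>+ z)"
| kat_plus_comm: "H \<turnstile> x \<^bold>+ y \<approx> y \<^bold>+ x"
| kat_plus_idem: "H \<turnstile> x \<^bold>+ x \<approx> x"
| kat_plus_zero: "H \<turnstile> x \<^bold>+ \<^bold>0 \<approx> x"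
| kat_mult_assoc: "H \<turnstile> (x \<^bold>; y) \<^bold>; z \<approx> x \<^bold>; (y \<^bold>; z)"
| kat_one_mult: "H \<turnstile> \<^bold>1 \<^bold>; x \<approx> x"
| kat_mult_one: "H \<turnstile> x \<^bold>; \<^bold>1 \<approx> x"
| kat_zero_mult: "H \<turnstile> \<^bold>0 \<^bold>; x \<approx> \<^bold>0"
| kat_mult_zero: "H \<turnstile> x \<^bold>; \<^bold>0 \<approx> \<^bold>0"
| kat_distl: "H \<turnstile> x \<^bold>; (y \<^bold>+ z) \<approx> x \<^bold>; y \<^bold>+ x \<^bold>; z"
| kat_distr: "H \<turnstile> (x \<^bold>+ y) \<^bold>; z \<approx> x \<^bold>; z \<^bold>+ y \<^bold>; z"
| kat_test_comm: "H \<turnstile> Test p \<^bold>; Test q \<approx> Test q \<^bold>; Test p"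
| kat_test_idem: "H \<turnstile> Test p \<^bold>; Test p \<approx> Test p"
| kat_test_dist: "H \<turnstile> Test p \<^bold>+ Test q \<^bold>; Test r \<approx> (Test p \<^bold>+ Test q) \<^bold>; (Test p \<^bold>+ Test r)"
| kat_test_top: "H \<turnstile> Test p \<^bold>+ \<^bold>1 \<approx> \<^bold>1"
| kat_test_compl_plus: "H \<turnstile> Test p \<^bold>+ Test (TNeg p) \<approx> \<^bold>1"
| kat_test_compl_mult: "H \<turnstile> Test p \<^bold>; Test (TNeg p) \<approx> \<^bold>0"
  (* an inequation x \<le> y is the equation x + y = y *)
| kat_star_unfoldl: "H \<turnstile> \<^bold>1 \<^bold>+ x \<^bold>; Star x \<approx> Star x"
| kat_star_unfoldr: "H \<turnstile> \<^bold>1 \<^bold>+ Star x \<^bold>; x \<approx> Star x"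
| kat_star_inductl: "H \<turnstile> (y \<^bold>+ x \<^bold>; z) \<^bold>+ z \<approx> z \<Longrightarrow> H \<turnstile> Star x \<^bold>; y \<^bold>+ z \<approx> z"
| kat_star_inductr: "H \<turnstile> (y \<^bold>+ z \<^bold>; x) \<^bold>+ z \<approx> z \<Longrightarrow> H \<turnstile> y \<^bold>; Star x \<^bold>+ z \<approx> z"

datatype 'v act = AAssign 'v "'v iexp" | AHavoc 'v

type_synonym 'v ckat = "('v pexp, 'v act) kat"

fun btrans :: "'v bexp \<Rightarrow> 'v pexp tst" where
  "btrans (Prim p) = TPrim p"
| "btrans (BNot b) = TNeg (btrans b)"
| "btrans (BAnd b c) = TMult (btrans b) (btrans c)"
| "btrans (BOr b c) = TPlus (btrans b) (btrans c)"

fun ksum :: "('p, 'a) kat list \<Rightarrow> ('p, 'a) kat" where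
  "ksum [] = \<^bold>0"
| "ksum [x] = x"
| "ksum (x # y # xs) = x \<^bold>+ ksum (y # xs)"

fun ctrans :: "'v cmd \<Rightarrow> 'v ckat" where
  "ctrans Skip = \<^bold>1"
| "ctrans (Assign x e) = Act (AAssign x e)"
| "ctrans (Havoc x) = Act (AHavoc x)"
| "ctrans (Seq c d) = ctrans c \<^bold>; ctrans d"
| "ctrans (IfFi gcs) = ksum (map (\<lambda>(e, c). Test (btrans e) \<^bold>; ctrans c) gcs)"
| "ctrans (DoOd gcs) =
     Star (ksum (map (\<lambda>(e, c). Test (btrans e) \<^bold>; ctrans c) gcs)) \<^bold>; Test (TNeg (btrans (enab gcs)))"

inductive_set Hyp :: "('v ckat \<times> 'v ckat) set" where
  hyp_unsat: "(\<forall>s. \<not> bval e s) \<Longrightarrow> (Test (btrans e), \<^bold>0) \<in> Hyp"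
| hyp_assign: "(\<forall>s. bval e0 s \<longrightarrow> bval (bsubst e1 x e) s) \<Longrightarrow>
    (Test (btrans e0) \<^bold>; Act (AAssign x e) \<^bold>; Test (TNeg (btrans e1)), \<^bold>0) \<in> Hyp"
| hyp_havoc: "(\<forall>s. bval e0 s \<longrightarrow> (\<forall>v. bval e1 (s(x := v)))) \<Longrightarrow>
    (Test (btrans e0) \<^bold>; Act (AHavoc x) \<^bold>; Test (TNeg (btrans e1)), \<^bold>0) \<in> Hyp"

definition kat_equiv :: "'v cmd \<Rightarrow> 'v cmd \<Rightarrow> bool" (infix "\<simeq>" 50) where
  "c \<simeq> d \<longleftrightarrow> Hyp \<turnstile> ctrans c \<approx> ctrans d"


section \<open>Relational formulas\<close>

definition leftp :: "'v store set \<Rightarrow> 'v srel" ("\<langle>_]") where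
  "\<langle>P] = {(s, s'). s \<in> P}"

definition rightp :: "'v store set \<Rightarrow> 'v srel" ("[_\<rangle>") where
  "[P\<rangle> = {(s, s'). s' \<in> P}"

definition bagree :: "'v bexp \<Rightarrow> 'v bexp \<Rightarrow> 'v srel" where
  "bagree b b' = {(s, s'). bval b s = bval b' s'}"

definition substl :: "'v srel \<Rightarrow> 'v \<Rightarrow> 'v iexp \<Rightarrow> 'v srel" where
  "substl R x e = {(s, s'). (s(x := ival e s), s') \<in> R}"

definition substr :: "'v srel \<Rightarrow> 'v \<Rightarrow> 'v iexp \<Rightarrow> 'v srel" where
  "substr R x e = {(s, s'). (s, s'(x := ival e s')) \<in> R}"

definition alll :: "'v \<Rightarrow> 'v srel \<Rightarrow> 'v srel" where
  "alll x P = {(s, s'). \<forall>v. (s(x := v), s') \<in> P}"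

definition exr :: "'v \<Rightarrow> 'v srel \<Rightarrow> 'v srel" where
  "exr x P = {(s, s'). \<exists>v. (s, s'(x := v)) \<in> P}"

definition indep :: "'v \<Rightarrow> 'v \<Rightarrow> 'v srel \<Rightarrow> bool" where
  "indep x x' R \<longleftrightarrow> R = {(s, s'). \<exists>v v'. (s(x := v), s'(x' := v')) \<in> R}"


section \<open>Judgments and rules\<close>

datatype 'v judg =
  Judgment (lcmd: "'v cmd") (rcmd: "'v cmd") (pre: "'v srel") (post: "'v srel")
  ("_ \<parallel> _ \<Ztypecolon> \<langle>_ \<leadsto> _\<rangle>" [56, 56, 0, 0] 55)

definition valid :: "'v judg \<Rightarrow> bool" where
  "valid j \<longleftrightarrow> (\<forall>s s' t. (s, s') \<in> pre j \<and> (s, t) \<in> den (lcmd j) \<longrightarrow>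
     (\<exists>t'. (s', t') \<in> den (rcmd j) \<and> (t, t') \<in> post j))"

definition wf_judgment :: "'v judg \<Rightarrow> bool" where
  "wf_judgment j \<longleftrightarrow> wf_cmd (lcmd j) \<and> wf_cmd (rcmd j)"

(* The pairs of a set of judgment premises and a conclusion that are instances of a rule whose
   side conditions hold.  The type argument is the carrier type of the well-founded sets that
   may be used in eDo. *)
inductive erhl_rule :: "'d itself \<Rightarrow> 'v judg set \<Rightarrow> 'v judg \<Rightarrow> bool"
  for ty :: "'d itself" where
  eGhost: "\<lbrakk>ghost x c; ghost x' c'; indep x x' R; indep x x' S\<rbrakk> \<Longrightarrow>
    erhl_rule ty {c \<parallel> c' \<Ztypecolon> \<langle>R \<leadsto> S\<rangle>} (erase x c \<parallel> erase x' c' \<Ztypecolon> \<langle>R \<leadsto> S\<rangle>)"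
| eRewrite: "\<lbrakk>c \<simeq> d; c' \<simeq> d'\<rbrakk> \<Longrightarrow>
    erhl_rule ty {c \<parallel> c' \<Ztypecolon> \<langle>R \<leadsto> S\<rangle>} (d \<parallel> d' \<Ztypecolon> \<langle>R \<leadsto> S\<rangle>)"
| eSkip: "erhl_rule ty {} (Skip \<parallel> Skip \<Ztypecolon> \<langle>R \<leadsto> R\<rangle>)"
| eAsgnSkip: "erhl_rule ty {} (Assign x e \<parallel> Skip \<Ztypecolon> \<langle>substl R x e \<leadsto> R\<rangle>)"
| eSkipAsgn: "erhl_rule ty {} (Skip \<parallel> Assign x e \<Ztypecolon> \<langle>substr R x e \<leadsto> R\<rangle>)"
| eHavSkip: "erhl_rule ty {} (Havoc x \<parallel> Skip \<Ztypecolon> \<langle>alll x P \<leadsto> P\<rangle>)"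
| eSkipHav: "erhl_rule ty {} (Skip \<parallel> Havoc x \<Ztypecolon> \<langle>exr x P \<leadsto> P\<rangle>)"
| eSeq: "erhl_rule ty {c \<parallel> c' \<Ztypecolon> \<langle>R \<leadsto> S\<rangle>, d \<parallel> d' \<Ztypecolon> \<langle>S \<leadsto> T\<rangle>}
    (Seq c d \<parallel> Seq c' d' \<Ztypecolon> \<langle>R \<leadsto> T\<rangle>)"
| eIf: "erhl_rule ty
    {c \<parallel> c' \<Ztypecolon> \<langle>R \<inter> \<langle>bset e] \<inter> [bset e'\<rangle> \<leadsto> S\<rangle> | e c e' c'. (e, c) \<in> set gcs \<and> (e', c') \<in> set gcs'}
    (IfFi gcs \<parallel> IfFi gcs' \<Ztypecolon> \<langle>R \<leadsto> S\<rangle>)"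
| eDo: "\<lbrakk>wfp_on D prec; \<forall>s. V s \<in> (D :: 'd set);
      Q \<subseteq> bagree (enab gcs) (enab gcs') \<union> (L \<inter> \<langle>bset (enab gcs)]) \<union> (R \<inter> [bset (enab gcs')\<rangle>)\<rbrakk> \<Longrightarrow>
    erhl_rule ty
     ({c \<parallel> Skip \<Ztypecolon> \<langle>Q \<inter> \<langle>bset e] \<inter> L \<leadsto> Q\<rangle> | e c. (e, c) \<in> set gcs}
      \<union> {Skip \<parallel> c' \<Ztypecolon> \<langle>Q \<inter> [bset e'\<rangle> \<inter> R \<inter> [{s'. V s' = k}\<rangle> \<leadsto> Q \<inter> [{s'. prec (V s') k}\<rangle>\<rangle>
           | e' c' k. (e', c') \<in> set gcs' \<and> k \<in> D}
      \<union> {c \<parallel> c' \<Ztypecolon> \<langle>Q \<inter> \<langle>bset e] \<inter> [bset e'\<rangle> \<inter> - L \<inter> - R \<leadsto> Q\<rangle>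
           | e c e' c'. (e, c) \<in> set gcs \<and> (e', c') \<in> set gcs'})
     (DoOd gcs \<parallel> DoOd gcs' \<Ztypecolon> \<langle>Q \<leadsto> Q \<inter> - \<langle>bset (enab gcs)] \<inter> - [bset (enab gcs')\<rangle>\<rangle>)"
| eConseq: "\<lbrakk>P \<subseteq> R; S \<subseteq> Q\<rbrakk> \<Longrightarrow>
    erhl_rule ty {c \<parallel> d \<Ztypecolon> \<langle>R \<leadsto> S\<rangle>} (c \<parallel> d \<Ztypecolon> \<langle>P \<leadsto> Q\<rangle>)"
| eDisj: "erhl_rule ty {c \<parallel> d \<Ztypecolon> \<langle>Q \<leadsto> S\<rangle>, c \<parallel> d \<Ztypecolon> \<langle>R \<leadsto> S\<rangle>} (c \<parallel> d \<Ztypecolon> \<langle>Q \<union> R \<leadsto> S\<rangle>)"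
| eFalse: "erhl_rule ty {} (c \<parallel> d \<Ztypecolon> \<langle>{} \<leadsto> R\<rangle>)"

end

theory Submission
  imports Defs
begin

text \<open>
  Rewriting is sound because binary relations on stores, with subidentities as tests, form a
  Kleene algebra with tests that satisfies all hypotheses. Ghost erasure is sound because a
  command and its erasure are bisimilar up to the value of the ghost variable. For loops, the
  right-hand execution is built by induction on the remaining left-hand iterations and, for a
  fixed left-hand store, on the variant, which bounds the number of consecutive iterations on
  the right alone.
\<close>

section \<open>Denotations of guarded commands\<close>

text \<open>The one-step relation that \<open>den\<close> writes out both for alternatives and for
  loop bodies; with a name, one simulation argument serves both.\<close>

definition gc_den :: "'v gcs \<Rightarrow> 'v srel" where
  "gc_den gcs = (\<Union>(e, c) \<in> set gcs. {(s, t). bval e s \<and> (s, t) \<in> den c})"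

lemma mem_gc_den: "(s, t) \<in> gc_den gcs \<longleftrightarrow> (\<exists>(e, c) \<in> set gcs. bval e s \<and> (s, t) \<in> den c)"
  by (auto simp: gc_den_def)

lemma den_IfFi: "den (IfFi gcs) = gc_den gcs"
  by (simp add: gc_den_def)

lemma den_DoOd: "den (DoOd gcs) = {(s, t). (s, t) \<in> (gc_den gcs)\<^sup>* \<and> \<not> bval (enab gcs) t}"
  by (simp add: gc_den_def)

text \<open>Also true for the empty list, where \<open>enab\<close> is constantly false, so no
  nonemptiness assumption has to be carried along.\<close>

lemma bval_enab: "bval (enab gcs) s \<longleftrightarrow> (\<exists>(e, c) \<in> set gcs. bval e s)"
  by (induction gcs rule: enab.induct) auto

section \<open>Relational model of Kleene algebra with tests\<close>

fun tst_val :: "'v pexp tst \<Rightarrow> 'v store \<Rightarrow> bool" where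
  "tst_val TZero s = False"
| "tst_val TOne s = True"
| "tst_val (TPrim p) s = bval (Prim p) s"
| "tst_val (TNeg p) s = (\<not> tst_val p s)"
| "tst_val (TMult p q) s = (tst_val p s \<and> tst_val q s)"
| "tst_val (TPlus p q) s = (tst_val p s \<or> tst_val q s)"

fun act_den :: "'v act \<Rightarrow> 'v srel" where
  "act_den (AAssign x e) = den (Assign x e)"
| "act_den (AHavoc x) = den (Havoc x)"

fun kat_den :: "'v ckat \<Rightarrow> 'v srel" where
  "kat_den (Test p) = Id_on {s. tst_val p s}"
| "kat_den (Act a) = act_den a"
| "kat_den (x \<^bold>+ y) = kat_den x \<union> kat_den y"
| "kat_den (x \<^bold>; y) = kat_den x O kat_den y"
| "kat_den (Star x) = (kat_den x)\<^sup>*"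

lemma kat_den_One: "kat_den \<^bold>1 = Id"
  by auto

text \<open>Composition with a subidentity filters sources or, in the mirrored lemma, targets; this
  turns tests in products into pointwise conditions.\<close>

lemma Id_on_relcomp: "Id_on A O R = {(s, t). s \<in> A \<and> (s, t) \<in> R}"
  by auto

lemma relcomp_Id_on: "R O Id_on A = {(s, t). t \<in> A \<and> (s, t) \<in> R}"
  by auto

section \<open>Tests, substitution and the hypotheses in the relational model\<close>

lemma tst_val_btrans: "tst_val (btrans b) s = bval b s"
  by (induction b) auto

lemma ival_isubst: "ival (isubst a x e) s = ival a (s(x := ival e s))"
  by (induction a) (auto simp: comp_def cong: map_cong)

lemma bval_bsubst: "bval (bsubst b x e) s = bval b (s(x := ival e s))"
  by (induction b x e rule: bsubst.induct) (auto simp: ival_isubst comp_def fun_upd_def)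

text \<open>The hypotheses on actions are Hoare triples written as vanishing products: no execution
  starts in \<open>e0\<close> and ends outside \<open>e1\<close>. For assignments the side condition
  becomes this statement by the substitution lemma.\<close>

lemma kat_den_Hyp: "(x, y) \<in> Hyp \<Longrightarrow> kat_den x = kat_den y"
  by (induction rule: Hyp.induct) (auto simp: tst_val_btrans bval_bsubst)

text \<open>The left star induction axiom with inclusion as order: \<open>Z\<close> contains
  \<open>Y\<close> and is closed under prepending an \<open>X\<close> step, so walk the path
  backwards from its end. The right version walks forwards.\<close>

lemma rtrancl_inductl: "Y \<union> X O Z \<subseteq> Z \<Longrightarrow> X\<^sup>* O Y \<subseteq> Z"
proof
  fix p assume Z: "Y \<union> X O Z \<subseteq> Z" and "p \<in> X\<^sup>* O Y"
  then obtain a b c where p: "p = (a, c)" and "(a, b) \<in> X\<^sup>*" and Y: "(b, c) \<in> Y" by auto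
  from this(2) have "(a, c) \<in> Z"
    by (induction rule: converse_rtrancl_induct) (use Z Y in auto)
  with p show "p \<in> Z" by simp
qed

lemma rtrancl_inductr: "Y \<union> Z O X \<subseteq> Z \<Longrightarrow> Y O X\<^sup>* \<subseteq> Z"
proof
  fix p assume Z: "Y \<union> Z O X \<subseteq> Z" and "p \<in> Y O X\<^sup>*"
  then obtain a b c where p: "p = (a, c)" and "(b, c) \<in> X\<^sup>*" and Y: "(a, b) \<in> Y" by auto
  from this(2) have "(a, c) \<in> Z"
    by (induction rule: rtrancl_induct) (use Z Y in auto)
  with p show "p \<in> Z" by simp
qed

lemma kat_eq_sound: "Hyp \<turnstile> x \<approx> y \<Longrightarrow> kat_den x = kat_den y"
proof (induction rule: kat_eq.induct)
  case (kat_hyp x y)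
  then show ?case by (rule kat_den_Hyp)
next
  \<comment> \<open>A subidentity determines its test, because its domain is the set of stores
    satisfying the test; hence complements agree as well.\<close>
  case (kat_neg_cong p q)
  then have "{s. tst_val p s} = {s. tst_val q s}"
    by (metis Domain_Id_on kat_den.simps(1))
  then show ?case by (auto simp: set_eq_iff)
next
  case (kat_star_unfoldl x)
  have "Id \<union> kat_den x O (kat_den x)\<^sup>* = (kat_den x)\<^sup>*"
    by (metis rtrancl_unfold r_comp_rtrancl_eq)
  then show ?case by (simp only: kat_den.simps(3-5) kat_den_One)
next
  case (kat_star_unfoldr x)
  have "Id \<union> (kat_den x)\<^sup>* O kat_den x = (kat_den x)\<^sup>*"
    by (metis rtrancl_unfold)
  then show ?case by (simp only: kat_den.simps(3-5) kat_den_One)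
next
  case (kat_star_inductl y x z)
  then show ?case using rtrancl_inductl[of "kat_den y" "kat_den x" "kat_den z"] by auto
next
  case (kat_star_inductr y z x)
  then show ?case using rtrancl_inductr[of "kat_den y" "kat_den z" "kat_den x"] by auto
qed (auto simp: O_assoc Id_on_relcomp relcomp_Id_on)

section \<open>Agreement of the algebraic translation with the denotation of commands\<close>

lemma kat_den_ksum: "kat_den (ksum xs) = (\<Union>x \<in> set xs. kat_den x)"
  by (induction xs rule: ksum.induct) auto

lemma kat_den_guarded:
  assumes "\<And>e c. (e, c) \<in> set gcs \<Longrightarrow> kat_den (ctrans c) = den c"
  shows "kat_den (ksum (map (\<lambda>(e, c). Test (btrans e) \<^bold>; ctrans c) gcs)) = gc_den gcs"
proof -
  have "kat_den (case gc of (e, c) \<Rightarrow> Test (btrans e) \<^bold>; ctrans c)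
      = (case gc of (e, c) \<Rightarrow> {(s, t). bval e s \<and> (s, t) \<in> den c})" if "gc \<in> set gcs" for gc
    using assms that by (cases gc) (auto simp: Id_on_relcomp tst_val_btrans)
  then show ?thesis by (simp add: kat_den_ksum gc_den_def)
qed

lemma kat_den_ctrans: "kat_den (ctrans c) = den c"
proof (induction c rule: ctrans.induct)
  case (5 gcs)
  then show ?case by (simp add: kat_den_guarded den_IfFi del: den.simps)
next
  case (6 gcs)
  then show ?case by (auto simp: kat_den_guarded den_DoOd tst_val_btrans simp del: den.simps)
qed auto

text \<open>The only fact about rewriting that validity needs, since a judgment depends on its
  commands through their denotations alone.\<close>

lemma kat_equiv_sound: "c \<simeq> d \<Longrightarrow> den c = den d"
  by (metis kat_equiv_def kat_eq_sound kat_den_ctrans)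

section \<open>Ghost erasure\<close>

definition eq_off :: "'v \<Rightarrow> 'v store \<Rightarrow> 'v store \<Rightarrow> bool" where
  "eq_off x s t \<longleftrightarrow> (\<forall>y. y \<noteq> x \<longrightarrow> s y = t y)"

lemma eq_off_refl: "eq_off x s s"
  by (simp add: eq_off_def)

lemma eq_off_sym: "eq_off x s t \<Longrightarrow> eq_off x t s"
  by (simp add: eq_off_def)

lemma eq_off_iff_upd: "eq_off x s t \<longleftrightarrow> (\<exists>v. t = s(x := v))"
  by (auto simp: eq_off_def fun_eq_iff)

lemma ival_eq_off: "eq_off x s t \<Longrightarrow> x \<notin> ivars a \<Longrightarrow> ival a s = ival a t"
proof (induction a)
  case (Op f es)
  then have "map (\<lambda>e. ival e s) es = map (\<lambda>e. ival e t) es" by auto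
  then show ?case by (metis ival.simps(2))
qed (auto simp: eq_off_def)

lemma bval_eq_off: "eq_off x s t \<Longrightarrow> x \<notin> bvars b \<Longrightarrow> bval b s = bval b t"
proof (induction b)
  case (Prim p)
  obtain f es where p: "p = Pred f es" by (cases p)
  with Prim have "map (\<lambda>e. ival e s) es = map (\<lambda>e. ival e t) es"
    by (auto intro: ival_eq_off)
  then show ?case by (metis bval.simps(1) p)
qed auto

text \<open>One half of a bisimulation up to \<open>x\<close>. The halves are separate because the
  ghost rule uses them in opposite directions on its two sides.\<close>

definition simulates :: "'v \<Rightarrow> 'v srel \<Rightarrow> 'v srel \<Rightarrow> bool" where
  "simulates x A B \<longleftrightarrow>
     (\<forall>s t s1. (s, t) \<in> A \<longrightarrow> eq_off x s s1 \<longrightarrow> (\<exists>t1. (s1, t1) \<in> B \<and> eq_off x t t1))"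

lemma simulatesD:
  "simulates x A B \<Longrightarrow> (s, t) \<in> A \<Longrightarrow> eq_off x s s1 \<Longrightarrow> \<exists>t1. (s1, t1) \<in> B \<and> eq_off x t t1"
  by (auto simp: simulates_def)

lemma simulates_relcomp:
  "simulates x A B \<Longrightarrow> simulates x A' B' \<Longrightarrow> simulates x (A O A') (B O B')"
  unfolding simulates_def by blast

lemma simulates_rtrancl:
  assumes "simulates x A B" shows "simulates x (A\<^sup>*) (B\<^sup>*)"
  unfolding simulates_def
proof (intro allI impI)
  fix s t s1 assume "(s, t) \<in> A\<^sup>*" "eq_off x s s1"
  then show "\<exists>t1. (s1, t1) \<in> B\<^sup>* \<and> eq_off x t t1"
  proof (induction rule: rtrancl_induct)
    case (step t u)
    then show ?case by (meson assms simulatesD rtrancl.rtrancl_into_rtrancl)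
  qed auto
qed

lemma enab_erase: "bval (enab (map (\<lambda>(e, c). (e, erase x c)) gcs)) s = bval (enab gcs) s"
  by (force simp: bval_enab)

lemma enab_eq_off:
  assumes "\<forall>(e, c) \<in> set gcs. x \<notin> bvars e" and "eq_off x s t"
  shows "bval (enab gcs) s = bval (enab gcs) t"
  using assms bval_eq_off[of x s t] by (fastforce simp: bval_enab)

text \<open>Guards do not mention \<open>x\<close>, so the branch taken on one side is enabled on
  the other, and its body is simulated by assumption.\<close>

lemma simulates_gc_den_erase:
  assumes ghost: "\<And>e c. (e, c) \<in> set gcs \<Longrightarrow> x \<notin> bvars e"
    and sim: "\<And>e c. (e, c) \<in> set gcs \<Longrightarrow>
      simulates x (den c) (den (erase x c)) \<and> simulates x (den (erase x c)) (den c)"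
  shows "simulates x (gc_den gcs) (gc_den (map (\<lambda>(e, c). (e, erase x c)) gcs))" (is ?A)
    and "simulates x (gc_den (map (\<lambda>(e, c). (e, erase x c)) gcs)) (gc_den gcs)" (is ?B)
proof -
  show ?A
    unfolding simulates_def
  proof (intro allI impI)
    fix s t s1 assume "(s, t) \<in> gc_den gcs" and s1: "eq_off x s s1"
    then obtain e c where ec: "(e, c) \<in> set gcs" "bval e s" "(s, t) \<in> den c"
      by (auto simp: mem_gc_den)
    then obtain t1 where "(s1, t1) \<in> den (erase x c)" "eq_off x t t1"
      using sim s1 by (meson simulatesD)
    moreover have "bval e s1" using bval_eq_off[OF s1] ghost ec by auto
    ultimately show "\<exists>t1. (s1, t1) \<in> gc_den (map (\<lambda>(e, c). (e, erase x c)) gcs) \<and> eq_off x t t1"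
      using ec(1) by (force simp: mem_gc_den)
  qed
  show ?B
    unfolding simulates_def
  proof (intro allI impI)
    fix s t s1
    assume "(s, t) \<in> gc_den (map (\<lambda>(e, c). (e, erase x c)) gcs)" and s1: "eq_off x s s1"
    then obtain e c where ec: "(e, c) \<in> set gcs" "bval e s" "(s, t) \<in> den (erase x c)"
      by (auto simp: mem_gc_den)
    then obtain t1 where "(s1, t1) \<in> den c" "eq_off x t t1"
      using sim s1 by (meson simulatesD)
    moreover have "bval e s1" using bval_eq_off[OF s1] ghost ec by auto
    ultimately show "\<exists>t1. (s1, t1) \<in> gc_den gcs \<and> eq_off x t t1"
      using ec(1) by (force simp: mem_gc_den)
  qed
qed

text \<open>Iterations are matched one by one; agreement of the guards on related stores makes both
  loops stop together.\<close>

lemma simulates_DoOd: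
  assumes sim: "simulates x (gc_den gcs) (gc_den gcs')"
    and enab: "\<And>s t. eq_off x s t \<Longrightarrow> bval (enab gcs) s = bval (enab gcs') t"
  shows "simulates x (den (DoOd gcs)) (den (DoOd gcs'))"
  unfolding simulates_def
proof (intro allI impI)
  fix s t s1 assume "(s, t) \<in> den (DoOd gcs)" "eq_off x s s1"
  then show "\<exists>t1. (s1, t1) \<in> den (DoOd gcs') \<and> eq_off x t t1"
    using simulatesD[OF simulates_rtrancl[OF sim], of s t s1] enab
    by (auto simp: den_DoOd simp del: den.simps)
qed

lemma simulates_erase:
  "ghost x c \<Longrightarrow> simulates x (den c) (den (erase x c)) \<and> simulates x (den (erase x c)) (den c)"
proof (induction x c rule: erase.induct)
  \<comment> \<open>An assignment to \<open>x\<close> itself is matched by skip, as only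
    \<open>x\<close> changes. For any other target both sides assign the same value, since
    \<open>x\<close> does not occur in \<open>e\<close>.\<close>
  case (2 x y e)
  then have "ival e s = ival e t" if "eq_off x s t" for s t
    using that by (auto intro: ival_eq_off)
  then show ?case by (auto simp: simulates_def eq_off_def)
next
  case (3 x y)
  then show ?case
  proof (cases "y = x")
    case False
    have "simulates x (den (Havoc y)) (den (Havoc y))"
      unfolding simulates_def
    proof (intro allI impI)
      fix s t s1 :: "'a store" assume "(s, t) \<in> den (Havoc y)" and s1: "eq_off x s s1"
      then obtain v where "t = s(y := v)" by auto
      then have "(s1, s1(y := v)) \<in> den (Havoc y) \<and> eq_off x t (s1(y := v))"
        using s1 by (auto simp: eq_off_def)
      then show "\<exists>t1. (s1, t1) \<in> den (Havoc y) \<and> eq_off x t t1" by blast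
    qed
    with False show ?thesis by simp
  next
    case True
    \<comment> \<open>Skip is matched by a havoc that chooses the old value of \<open>x\<close>;
      conversely, any havoc of \<open>x\<close> stays within \<open>eq_off\<close>.\<close>
    have "(s, s) \<in> den (Havoc x)" for s :: "'a store"
      by (auto intro: fun_upd_triv[symmetric])
    moreover have "eq_off x t s" if "(s, t) \<in> den (Havoc x)" for s t :: "'a store"
      using that by (auto simp: eq_off_def)
    ultimately show ?thesis
      using True by (auto simp: simulates_def eq_off_def simp del: den.simps(3)) metis
  qed
next
  case (4 x c d)
  then show ?case by (auto intro: simulates_relcomp)
next
  case (5 x gcs)
  then show ?case
    using simulates_gc_den_erase[of gcs x] by (fastforce simp: den_IfFi simp del: den.simps)
next
  case (6 x gcs)
  have sim: "simulates x (gc_den gcs) (gc_den (map (\<lambda>(e, c). (e, erase x c)) gcs))"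
    "simulates x (gc_den (map (\<lambda>(e, c). (e, erase x c)) gcs)) (gc_den gcs)"
    using 6 by (intro simulates_gc_den_erase; fastforce)+
  have "bval (enab gcs) s = bval (enab gcs) t" if "eq_off x s t" for s t
    using 6 that by (intro enab_eq_off[of gcs x]) auto
  then show ?case
    using sim by (auto intro!: simulates_DoOd simp: enab_erase simp del: den.simps)
qed (auto simp: simulates_def)

text \<open>The original pair \<open>(s, s')\<close> arises from \<open>(t, t')\<close> by updating
  the ghost variables, so it is the witness for the existential in \<open>indep\<close>.\<close>

lemma indep_eq_off:
  assumes "indep x x' R" "(s, s') \<in> R" "eq_off x s t" "eq_off x' s' t'"
  shows "(t, t') \<in> R"
proof -
  obtain v v' where "s = t(x := v)" "s' = t'(x' := v')"
    using assms(3,4) by (meson eq_off_sym eq_off_iff_upd)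
  then have "(t, t') \<in> {(s, s'). \<exists>v v'. (s(x := v), s'(x' := v')) \<in> R}"
    using assms(2) by auto
  then show ?thesis using assms(1) unfolding indep_def by blast
qed

section \<open>Soundness of the rules\<close>

lemma validI:
  assumes "\<And>s s' t. (s, s') \<in> R \<Longrightarrow> (s, t) \<in> den c \<Longrightarrow> \<exists>t'. (s', t') \<in> den c' \<and> (t, t') \<in> S"
  shows "valid (c \<parallel> c' \<Ztypecolon> \<langle>R \<leadsto> S\<rangle>)"
  using assms by (auto simp: valid_def)

lemma validD:
  assumes "valid (c \<parallel> c' \<Ztypecolon> \<langle>R \<leadsto> S\<rangle>)" "(s, s') \<in> R" "(s, t) \<in> den c"
  obtains t' where "(s', t') \<in> den c'" "(t, t') \<in> S"
  using assms unfolding valid_def judg.sel by blast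

text \<open>An erased left run is lifted to a run of \<open>c\<close>, the premise supplies a run of
  \<open>c'\<close>, and this is projected to its erasure. The final stores move only at the ghost
  variables, which \<open>S\<close> ignores.\<close>

lemma eGhost_sound:
  assumes "ghost x c" "ghost x' c'" "indep x x' S" and v: "valid (c \<parallel> c' \<Ztypecolon> \<langle>R \<leadsto> S\<rangle>)"
  shows "valid (erase x c \<parallel> erase x' c' \<Ztypecolon> \<langle>R \<leadsto> S\<rangle>)"
proof (rule validI)
  fix s s' t assume R: "(s, s') \<in> R" and "(s, t) \<in> den (erase x c)"
  then obtain u where u: "(s, u) \<in> den c" "eq_off x t u"
    using simulates_erase[OF assms(1)] eq_off_refl by (meson simulatesD)
  obtain u' where u': "(s', u') \<in> den c'" "(u, u') \<in> S"
    using validD[OF v R u(1)] .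
  then obtain t' where t': "(s', t') \<in> den (erase x' c')" "eq_off x' u' t'"
    using simulates_erase[OF assms(2)] eq_off_refl by (meson simulatesD)
  have "(t, t') \<in> S"
    using indep_eq_off[OF assms(3) u'(2) eq_off_sym[OF u(2)] t'(2)] .
  with t' show "\<exists>t'. (s', t') \<in> den (erase x' c') \<and> (t, t') \<in> S" by blast
qed

lemma eIf_sound:
  assumes enab: "bvalid (enab gcs')"
    and prem: "\<And>e c e' c'. (e, c) \<in> set gcs \<Longrightarrow> (e', c') \<in> set gcs' \<Longrightarrow>
      valid (c \<parallel> c' \<Ztypecolon> \<langle>R \<inter> \<langle>bset e] \<inter> [bset e'\<rangle> \<leadsto> S\<rangle>)"
  shows "valid (IfFi gcs \<parallel> IfFi gcs' \<Ztypecolon> \<langle>R \<leadsto> S\<rangle>)"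
proof (rule validI)
  fix s s' t assume R: "(s, s') \<in> R" and "(s, t) \<in> den (IfFi gcs)"
  then obtain e c where ec: "(e, c) \<in> set gcs" "bval e s" "(s, t) \<in> den c" by auto
  \<comment> \<open>The matching branch is any right branch enabled at \<open>s'\<close>; validity
    of the right \<open>enab\<close> guarantees one.\<close>
  obtain e' c' where ec': "(e', c') \<in> set gcs'" "bval e' s'"
    using enab unfolding bvalid_def bval_enab by blast
  have "(s, s') \<in> R \<inter> \<langle>bset e] \<inter> [bset e'\<rangle>"
    using R ec ec' by (simp add: leftp_def rightp_def bset_def)
  then obtain t' where "(s', t') \<in> den c'" "(t, t') \<in> S"
    using validD[OF prem[OF ec(1) ec'(1)]] ec(3) by metis
  then show "\<exists>t'. (s', t') \<in> den (IfFi gcs') \<and> (t, t') \<in> S"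
    using ec' by auto
qed

text \<open>Right-only moves get priority: at each left store they are exhausted first. Only then is
  the next left iteration matched, by skip inside \<open>L\<close> and by a joint step
  outside.\<close>

lemma eDo_sound:
  assumes wf: "wfp_on D prec" and V: "\<And>s. V s \<in> D"
    and Q: "Q \<subseteq> bagree (enab gcs) (enab gcs') \<union> (L \<inter> \<langle>bset (enab gcs)])
      \<union> (R \<inter> [bset (enab gcs')\<rangle>)"
    and left: "\<And>e c. (e, c) \<in> set gcs \<Longrightarrow> valid (c \<parallel> Skip \<Ztypecolon> \<langle>Q \<inter> \<langle>bset e] \<inter> L \<leadsto> Q\<rangle>)"
    and right: "\<And>e' c' k. (e', c') \<in> set gcs' \<Longrightarrow> k \<in> D \<Longrightarrow>
      valid (Skip \<parallel> c' \<Ztypecolon> \<langle>Q \<inter> [bset e'\<rangle> \<inter> R \<inter> [{s'. V s' = k}\<rangle> \<leadsto> Q \<inter> [{s'. prec (V s') k}\<rangle>\<rangle>)"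
    and both: "\<And>e c e' c'. (e, c) \<in> set gcs \<Longrightarrow> (e', c') \<in> set gcs' \<Longrightarrow>
      valid (c \<parallel> c' \<Ztypecolon> \<langle>Q \<inter> \<langle>bset e] \<inter> [bset e'\<rangle> \<inter> - L \<inter> - R \<leadsto> Q\<rangle>)"
  shows "valid (DoOd gcs \<parallel> DoOd gcs' \<Ztypecolon>
    \<langle>Q \<leadsto> Q \<inter> - \<langle>bset (enab gcs)] \<inter> - [bset (enab gcs')\<rangle>\<rangle>)"
proof -
  note rels = leftp_def rightp_def bset_def bagree_def
  let ?ends = "\<lambda>s' t t'. (s', t') \<in> (gc_den gcs')\<^sup>* \<and> (t, t') \<in> Q \<and> \<not> bval (enab gcs') t'"
  \<comment> \<open>Reduces the search for a right run to stores where no right-only move is due;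
    \<open>other\<close> handles those.\<close>
  have right_first: "\<exists>t'. ?ends s' t t'"
    if "(s, s') \<in> Q"
      and other: "\<And>s'. (s, s') \<in> Q \<Longrightarrow> \<not> ((s, s') \<in> R \<and> bval (enab gcs') s') \<Longrightarrow>
        \<exists>t'. ?ends s' t t'"
    for s s' t
  proof -
    \<comment> \<open>Both left stores \<open>s\<close> and \<open>t\<close> stay fixed during
      right-only moves. The right store is quantified inside the induction on \<open>k\<close>,
      since it changes with each move.\<close>
    have "\<forall>s'. V s' = k \<longrightarrow> (s, s') \<in> Q \<longrightarrow> (\<exists>t'. ?ends s' t t')" if "k \<in> D" for k
      using wf
    proof (induction k rule: wfp_on_induct)
      case in_set
      show ?case using that .
    next
      case (less k)
      show ?case
      proof (intro allI impI)
        fix s' assume s': "V s' = k" "(s, s') \<in> Q"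
        show "\<exists>t'. ?ends s' t t'"
        proof (cases "(s, s') \<in> R \<and> bval (enab gcs') s'")
          case True
          then obtain e' c' where ec': "(e', c') \<in> set gcs'" "bval e' s'"
            by (auto simp: bval_enab)
          have "(s, s') \<in> Q \<inter> [bset e'\<rangle> \<inter> R \<inter> [{s'. V s' = k}\<rangle>"
            using True s' ec' by (simp add: rels)
          then obtain u' where u': "(s', u') \<in> den c'" "(s, u') \<in> Q" "prec (V u') k"
            using validD[OF right[OF ec'(1) less.hyps(1)], of s s' s] by (auto simp: rels)
          then obtain t' where "?ends u' t t'" using less.IH V by blast
          moreover have "(s', u') \<in> gc_den gcs'" using ec' u' by (auto simp: mem_gc_den)
          ultimately show ?thesis by (meson converse_rtrancl_into_rtrancl)
        qed (use other s' in blast)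
      qed
    qed
    with V that(1) show ?thesis by blast
  qed
  have main: "\<exists>t'. ?ends s' t t'"
    if "(s, t) \<in> (gc_den gcs)\<^sup>*" "\<not> bval (enab gcs) t" "(s, s') \<in> Q" for s s' t
    using that
  proof (induction arbitrary: s' rule: converse_rtrancl_induct)
    case base
    from base(2) show ?case
    proof (rule right_first)
      fix s' assume "(t, s') \<in> Q" "\<not> ((t, s') \<in> R \<and> bval (enab gcs') s')"
      \<comment> \<open>The left guard is false at \<open>t\<close>, which excludes the
        \<open>L\<close> alternative of the side condition, and the \<open>R\<close> alternative is
        excluded by assumption. So the guards agree, the right loop stops too, and \<open>s'\<close>
        is the final store.\<close>
      then have "?ends s' t s'" using Q base(1) by (auto simp: rels)
      then show "\<exists>t'. ?ends s' t t'" by blast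
    qed
  next
    case (step s u)
    from step(1) obtain e c where ec: "(e, c) \<in> set gcs" "bval e s" "(s, u) \<in> den c"
      by (auto simp: mem_gc_den)
    then have enab: "bval (enab gcs) s" by (auto simp: bval_enab)
    from step.prems(2) show ?case
    proof (rule right_first)
      fix s' assume s': "(s, s') \<in> Q" "\<not> ((s, s') \<in> R \<and> bval (enab gcs') s')"
      show "\<exists>t'. ?ends s' t t'"
      proof (cases "(s, s') \<in> L")
        case True
        \<comment> \<open>The left body advances alone: skip leaves \<open>s'\<close> in place, and
          the induction hypothesis resumes from \<open>(u, s')\<close>.\<close>
        have "(s, s') \<in> Q \<inter> \<langle>bset e] \<inter> L" using True s' ec by (simp add: rels)
        then have "(u, s') \<in> Q" by (rule validD[OF left[OF ec(1)] _ ec(3)]) simp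
        then show ?thesis using step.IH step.prems(1) by blast
      next
        case False
        \<comment> \<open>Outside \<open>L\<close> and with no right-only move due, the side
          condition leaves only agreement of the guards. So the right loop is enabled, and
          \<open>(s, s')\<close> must lie outside \<open>R\<close>, as the joint premise
          demands.\<close>
        then have "bval (enab gcs') s'" using Q s' enab by (auto simp: rels)
        with s' obtain e' c' where ec': "(e', c') \<in> set gcs'" "bval e' s'" "(s, s') \<notin> R"
          by (auto simp: bval_enab)
        have "(s, s') \<in> Q \<inter> \<langle>bset e] \<inter> [bset e'\<rangle> \<inter> - L \<inter> - R"
          using False s' ec ec' by (simp add: rels)
        then obtain u' where u': "(s', u') \<in> den c'" "(u, u') \<in> Q"
          by (rule validD[OF both[OF ec(1) ec'(1)] _ ec(3)])
        then obtain t' where "?ends u' t t'" using step.IH step.prems(1) by blast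
        moreover have "(s', u') \<in> gc_den gcs'" using ec' u' by (auto simp: mem_gc_den)
        ultimately show ?thesis by (meson converse_rtrancl_into_rtrancl)
      qed
    qed
  qed
  show ?thesis
  proof (rule validI)
    fix s s' t assume "(s, s') \<in> Q" "(s, t) \<in> den (DoOd gcs)"
    then show "\<exists>t'. (s', t') \<in> den (DoOd gcs')
        \<and> (t, t') \<in> Q \<inter> - \<langle>bset (enab gcs)] \<inter> - [bset (enab gcs')\<rangle>"
      using main[of s t s'] by (auto simp: den_DoOd rels simp del: den.simps)
  qed
qed

theorem theorem7p1:
  fixes prems :: "'v judg set" and concl :: "'v judg"
  assumes "\<forall>j \<in> prems. wf_judgment j" and "wf_judgment concl"
    and "erhl_rule TYPE('d) prems concl"
    and "\<forall>j \<in> prems. valid j"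
  shows "valid concl"
  using assms(3)
proof (cases rule: erhl_rule.cases)
  case (eGhost x c x' c' R S)
  then show ?thesis using assms(4) by (auto intro: eGhost_sound)
next
  case (eRewrite c d c' d' R S)
  then have "valid (c \<parallel> c' \<Ztypecolon> \<langle>R \<leadsto> S\<rangle>)" "den c = den d" "den c' = den d'"
    using assms(4) kat_equiv_sound by auto
  then show ?thesis unfolding eRewrite(2) by (simp add: valid_def)
next
  case (eSeq c c' R S d d' T)
  then have "valid (c \<parallel> c' \<Ztypecolon> \<langle>R \<leadsto> S\<rangle>)" "valid (d \<parallel> d' \<Ztypecolon> \<langle>S \<leadsto> T\<rangle>)"
    using assms(4) by auto
  then show ?thesis unfolding eSeq(2) valid_def by simp blast
next
  case (eIf R S gcs gcs')
  \<comment> \<open>Well-formedness of the conclusion provides totality of the right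
    alternative.\<close>
  have "bvalid (enab gcs')" using assms(2) eIf by (simp add: wf_judgment_def)
  then show ?thesis unfolding eIf(2) by (rule eIf_sound) (use assms(4) eIf(1) in blast)
next
  case (eDo D prec V Q gcs gcs' L R)
  \<comment> \<open>The premises form a union of three families; each obligation below selects its
    family by \<open>UnI1\<close> and \<open>UnI2\<close> and reads off the instance.\<close>
  note prem = assms(4)[unfolded eDo(1), rule_format]
  show ?thesis unfolding eDo(2)
  proof (rule eDo_sound[OF eDo(3) _ eDo(5)])
    show "V s \<in> D" for s using eDo(4) by blast
    show "valid (c \<parallel> Skip \<Ztypecolon> \<langle>Q \<inter> \<langle>bset e] \<inter> L \<leadsto> Q\<rangle>)" if "(e, c) \<in> set gcs" for e c
      by (rule prem, rule UnI1, rule UnI1, rule CollectI, (rule exI)+, rule conjI, rule refl, rule that)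
    show "valid (Skip \<parallel> c' \<Ztypecolon> \<langle>Q \<inter> [bset e'\<rangle> \<inter> R \<inter> [{s'. V s' = k}\<rangle> \<leadsto> Q \<inter> [{s'. prec (V s') k}\<rangle>\<rangle>)"
      if "(e', c') \<in> set gcs'" "k \<in> D" for e' c' k
      by (rule prem, rule UnI1, rule UnI2, rule CollectI, (rule exI)+, rule conjI, rule refl)
        (simp add: that)
    show "valid (c \<parallel> c' \<Ztypecolon> \<langle>Q \<inter> \<langle>bset e] \<inter> [bset e'\<rangle> \<inter> - L \<inter> - R \<leadsto> Q\<rangle>)"
      if "(e, c) \<in> set gcs" "(e', c') \<in> set gcs'" for e c e' c'
      by (rule prem, rule UnI2, rule CollectI, (rule exI)+, rule conjI, rule refl)
        (simp add: that)
  qed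
next
  case (eConseq P R S Q c d)
  then have "valid (c \<parallel> d \<Ztypecolon> \<langle>R \<leadsto> S\<rangle>)" using assms(4) by auto
  then show ?thesis using eConseq(3,4) unfolding eConseq(2) valid_def judg.sel by blast
next
  case (eDisj c d Q S R)
  then have "valid (c \<parallel> d \<Ztypecolon> \<langle>Q \<leadsto> S\<rangle>)" "valid (c \<parallel> d \<Ztypecolon> \<langle>R \<leadsto> S\<rangle>)"
    using assms(4) by auto
  then show ?thesis unfolding eDisj(2) valid_def judg.sel by blast
qed (auto simp: valid_def substl_def substr_def alll_def exr_def)

end
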